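(* Let $G$ be a graph of order $n\ge 2$ such that both $G$ and $\overline G$ are connected. Then $$\mathcal K(G)\,\mathcal K(\overline G)\le \frac{3+\sqrt5}{2}\,n^4.$$ In particular, $\mathcal K(G)\,\mathcal K(\overline G)=O(n^4)$ (with an absolute implied constant).
   Context: All graphs are finite, simple, undirected and unweighted. The order of a graph is its number of vertices. The complement $\overline G$ is the graph on $V(G)$ in which two distinct vertices are adjacent if and only if they are nonadjacent in $G$. For a connected graph $H$ with $m\ge 1$ edges, Kemeny's constant is $\mathcal K(H)=\sum_{j\in V(H)}\frac{d_H(j)}{2m}E_iT_j$, where $d_H(j)$ is the degree of $j$ and $E_iT_j$ is the expected hitting time of $j$ for the simple random walk on $H$ started at $i$ (with $E_iT_i=0$); this does not depend on $i$. Equivalently, $\mathcal K(H)=\frac1{4m}\sum_{u\in V(H)}\sum_{v\in V(H)}d_H(u)d_H(v)r_H(u,v)$, where $r_H(u,v)$ is the effective resistance between $u$ and $v$ when each edge is a $1$-ohm resistor; also equivalently, $\mathcal K(H)=\sum_{i=2}^{n} 1/\lambda_i$, where $n=|V(H)|$ and $0=\lambda_1<\lambda_2\le\dots\le\lambda_n$ are the eigenvalues of the normalized Laplacian $I-D^{-1/2}AD^{-1/2}$ ($A$ the adjacency matrix and $D$ the diagonal degree matrix of $H$). *)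

theory Defs
  imports "HOL-Probability.Probability" "Graph_Theory.Graph_Theory"
begin

text \<open>
  Finite simple graphs are the \<open>pair_graph\<close>s of \<open>Graph_Theory\<close>, that is, finite loopfree
  symmetric arc relations. An edge \<open>{u, v}\<close> is the pair of arcs \<open>(u, v)\<close> and \<open>(v, u)\<close>, so a
  graph with \<open>m\<close> edges has \<open>card (parcs G) = 2 * m\<close>, and the out-degree is the degree.
\<close>

definition graph_complement :: "'a pair_pre_digraph \<Rightarrow> 'a pair_pre_digraph" where
  "graph_complement G =
    \<lparr> pverts = pverts G,
      parcs = {(u, v). u \<in> pverts G \<and> v \<in> pverts G \<and> u \<noteq> v \<and> (u, v) \<notin> parcs G} \<rparr>"

lemma pair_graph_graph_complement:
  assumes "pair_graph G"
  shows "pair_graph (graph_complement G)"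
proof -
  interpret pair_graph G by fact
  have fin: "finite (parcs (graph_complement G))"
    by (rule finite_subset[of _ "pverts G \<times> pverts G"]) (auto simp: graph_complement_def)
  have "sym (parcs G)"
    using pair_sym_arcs by (simp add: symmetric_def)
  then have "sym (parcs (graph_complement G))"
    by (auto simp: graph_complement_def sym_def)
  with fin show ?thesis
    by unfold_locales (auto simp: graph_complement_def symmetric_def)
qed

text \<open>
  The simple random walk started at \<open>i\<close> is the law on trajectories \<open>nat \<Rightarrow> 'a\<close> given by the
  Ionescu-Tulcea theorem. The kernel at time \<open>n\<close> sees the history \<open>\<omega>\<close> at times \<open>0, ..., n - 1\<close>.
\<close>

definition walk_kernel :: "'a pair_pre_digraph \<Rightarrow> 'a \<Rightarrow> nat \<Rightarrow> (nat \<Rightarrow> 'a) \<Rightarrow> 'a measure" where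
  "walk_kernel G i n \<omega> =
    measure_pmf (case n of 0 \<Rightarrow> return_pmf i | Suc k \<Rightarrow> pmf_of_set {v. (\<omega> k, v) \<in> parcs G})"

lemma Ionescu_Tulcea_walk_kernel: "Ionescu_Tulcea (walk_kernel G i) (\<lambda>_. count_space UNIV)"
proof (rule Ionescu_Tulcea.intro)
  fix n
  have *: "(\<lambda>x. measure_pmf (pmf_of_set {v. (x, v) \<in> parcs G}))
      \<in> count_space UNIV \<rightarrow>\<^sub>M subprob_algebra (count_space UNIV)"
    by (simp add: measure_pmf_in_subprob_algebra)
  show "walk_kernel G i n
      \<in> PiM {0..<n} (\<lambda>_. count_space UNIV) \<rightarrow>\<^sub>M subprob_algebra (count_space UNIV)"
  proof (cases n)
    case 0
    then show ?thesis
      unfolding walk_kernel_def[abs_def] by (simp add: measure_pmf_in_subprob_algebra)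
  next
    case (Suc k)
    have "(\<lambda>\<omega>. measure_pmf (pmf_of_set {v. (\<omega> k, v) \<in> parcs G}))
        \<in> PiM {0..<n} (\<lambda>_. count_space UNIV) \<rightarrow>\<^sub>M subprob_algebra (count_space UNIV)"
      by (rule measurable_compose[where f="\<lambda>\<omega>. \<omega> k", OF _ *])
        (auto intro!: measurable_component_singleton simp: Suc)
    with Suc show ?thesis
      unfolding walk_kernel_def[abs_def] by simp
  qed
qed (simp add: walk_kernel_def measure_pmf.prob_space_axioms)

definition random_walk :: "'a pair_pre_digraph \<Rightarrow> 'a \<Rightarrow> (nat \<Rightarrow> 'a) measure" where
  "random_walk G i =
    projective_family.lim UNIV
      (Ionescu_Tulcea.CI (walk_kernel G i) (\<lambda>_. count_space UNIV)) (\<lambda>_. count_space UNIV)"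

text \<open>Hence \<open>random_walk G i\<close> is the Markov chain with the intended finite-dimensional laws.\<close>

lemma emeasure_random_walk_prefix:
  "emeasure (random_walk G i) {\<omega>. \<forall>k\<le>n. \<omega> k = x k} =
    indicator {i} (x 0) * (\<Prod>k<n. ennreal (pmf (pmf_of_set {v. (x k, v) \<in> parcs G}) (x (Suc k))))"
proof -
  interpret IT: Ionescu_Tulcea "walk_kernel G i" "\<lambda>_. count_space UNIV"
    by (rule Ionescu_Tulcea_walk_kernel)
  let ?M = "\<lambda>_::nat. count_space (UNIV :: 'a set)"
  define X where "X n = PiE {0..<n} (\<lambda>k. {x k})" for n
  have X: "X n \<in> sets (PiM {0..<n} ?M)" for n
    unfolding X_def by (intro sets_PiM_I_finite) auto
  have u: "(\<lambda>_. undefined) \<in> space (PiM {0..<0} ?M)"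
    by (simp add: space_PiM)
  have step: "emeasure (IT.C 0 (Suc n) (\<lambda>_. undefined)) (X (Suc n)) =
      emeasure (walk_kernel G i n x) {x n} * emeasure (IT.C 0 n (\<lambda>_. undefined)) (X n)" for n
  proof -
    have "emeasure (IT.C 0 (Suc n) (\<lambda>_. undefined)) (X (Suc n)) =
        (\<integral>\<^sup>+\<omega>. emeasure (IT.eP n \<omega>) (X (Suc n)) \<partial>IT.C 0 n (\<lambda>_. undefined))"
    proof -
      have "IT.eP n \<in> IT.C 0 n (\<lambda>_. undefined) \<rightarrow>\<^sub>M subprob_algebra (PiM {0..<Suc n} ?M)"
        using IT.measurable_eP[of n] IT.sets_C[OF u, of n] by (simp cong: measurable_cong_sets)
      moreover have "space (IT.C 0 n (\<lambda>_. undefined)) \<noteq> {}"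
        using IT.space_C[OF u, of n] by (simp add: space_PiM PiE_eq_empty_iff)
      ultimately show ?thesis
        using X[of "Suc n"] by (simp add: emeasure_bind)
    qed
    also have "\<dots> = (\<integral>\<^sup>+\<omega>. emeasure (walk_kernel G i n x) {x n} * indicator (X n) \<omega>
        \<partial>IT.C 0 n (\<lambda>_. undefined))"
    proof (rule nn_integral_cong)
      fix \<omega> assume "\<omega> \<in> space (IT.C 0 n (\<lambda>_. undefined))"
      then have \<omega>: "\<omega> \<in> space (PiM {0..<n} ?M)"
        using IT.space_C[OF u, of n] by simp
      have vim: "fun_upd \<omega> n -` X (Suc n) = (if \<omega> \<in> X n then {x n} else {})"
        using \<omega> by (auto simp: X_def space_PiM PiE_iff extensional_def split: if_splits)
      have "walk_kernel G i n \<omega> = walk_kernel G i n x" if "\<omega> \<in> X n"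
        using that by (cases n) (auto simp: walk_kernel_def X_def PiE_iff)
      with vim show "emeasure (IT.eP n \<omega>) (X (Suc n)) =
          emeasure (walk_kernel G i n x) {x n} * indicator (X n) \<omega>"
        by (subst IT.emeasure_eP[OF \<omega> X]) auto
    qed
    also have "\<dots> = emeasure (walk_kernel G i n x) {x n} * emeasure (IT.C 0 n (\<lambda>_. undefined)) (X n)"
      using X[of n] IT.sets_C[OF u, of n] by (simp add: nn_integral_cmult_indicator)
    finally show ?thesis .
  qed
  have C: "emeasure (IT.C 0 (Suc n) (\<lambda>_. undefined)) (X (Suc n)) =
    indicator {i} (x 0) * (\<Prod>k<n. ennreal (pmf (pmf_of_set {v. (x k, v) \<in> parcs G}) (x (Suc k))))" for n
  proof (induction n)
    case 0
    have "emeasure (IT.C 0 0 (\<lambda>_. undefined)) (X 0) = 1"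
      using X[of 0] by (simp add: X_def)
    then show ?case
      by (subst step) (simp add: walk_kernel_def emeasure_pmf_single indicator_def del: IT.C.simps)
  next
    case (Suc n)
    show ?case
      by (subst step, subst Suc)
        (simp add: walk_kernel_def emeasure_pmf_single ac_simps del: IT.C.simps)
  qed
  have "{\<omega>. \<forall>k\<le>n. \<omega> k = x k} = IT.PF.emb UNIV {0..<Suc n} (X (Suc n))"
    by (auto simp: prod_emb_def X_def space_PiM PiE_iff)
  moreover have "IT.PF.emb {0..<Suc n} {0..<Suc n} (X (Suc n)) = X (Suc n)"
    by (rule prod_emb_id) (auto simp: X_def PiE_iff)
  moreover have "emeasure IT.PF.lim (IT.PF.emb UNIV {0..<Suc n} (X (Suc n))) =
      emeasure (IT.CI {0..<Suc n}) (X (Suc n))"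
    by (rule IT.lim) (use X in auto)
  moreover note IT.emeasure_CI[OF order_refl X[of "Suc n"]] C[of n]
  ultimately show ?thesis
    unfolding random_walk_def by (simp del: IT.C.simps)
qed

text \<open>The infimum is \<open>\<infinity>\<close> on trajectories that never visit \<open>j\<close>, and \<open>0\<close> on those that start at \<open>j\<close>.\<close>

definition hitting_time :: "'a \<Rightarrow> (nat \<Rightarrow> 'a) \<Rightarrow> ennreal" where
  "hitting_time j \<omega> = (INF t\<in>{t. \<omega> t = j}. of_nat t)"

definition expected_hitting_time :: "'a pair_pre_digraph \<Rightarrow> 'a \<Rightarrow> 'a \<Rightarrow> ennreal" where
  "expected_hitting_time G i j = (\<integral>\<^sup>+\<omega>. hitting_time j \<omega> \<partial>random_walk G i)"

definition kemeny_from :: "'a pair_pre_digraph \<Rightarrow> 'a \<Rightarrow> ennreal" where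
  "kemeny_from G i =
    (\<Sum>j\<in>pverts G. ennreal (real (out_degree (with_proj G) j) / real (card (parcs G)))
      * expected_hitting_time G i j)"

text \<open>For a connected graph with an edge, the sum has the same value for every starting vertex.\<close>

definition kemeny :: "'a pair_pre_digraph \<Rightarrow> ennreal" where
  "kemeny G = (THE k. \<forall>i\<in>pverts G. kemeny_from G i = k)"

end

theory Submission
  imports Defs
begin

text \<open>
  Write \<open>m\<close> and \<open>m'\<close> for the numbers of edges of the graph \<open>G\<close> and of its complement, and suppose
  that all effective resistances in them are at most \<open>\<rho>\<close> and \<open>\<rho>'\<close>. Every expected hitting time in
  \<open>G\<close> is at most \<open>2 * m * \<rho>\<close>, and Kemeny's constant is an average of hitting times, so it obeys the
  same bound. Since \<open>m + m' \<le> n\<^sup>2 / 2\<close>, the product of the two constants is at most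
  \<open>4 * m * m' * \<rho> * \<rho>' \<le> n ^ 4 / 4 * \<rho> * \<rho>'\<close>. It thus suffices to bound \<open>\<rho> * \<rho>'\<close> by a
  constant.

  The resistance between two vertices is at most their distance, so \<open>\<rho>\<close> can be taken to be the
  diameter \<open>D\<close>. If both diameters are at most \<open>3\<close>, then \<open>\<rho> * \<rho>' \<le> 9\<close>. Otherwise one of the two
  graphs, say \<open>G\<close>, has diameter \<open>D \<ge> 4\<close>. Long distances in \<open>G\<close> make the complement highly
  connected: vertices whose distances from an endpoint of a diameter differ by at least two are
  adjacent in the complement, so any two vertices are joined there by so many parallel paths of
  length at most two that \<open>\<rho>' = 2 / (D - 3)\<close> is possible (\<open>energy_complement_ge\<close>). Hence
  \<open>\<rho> * \<rho>' \<le> 2 * D / (D - 3) \<le> 8\<close>. Together this gives the bound \<open>9 / 4 * n ^ 4\<close>, and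
  \<open>9 / 4 < (3 + sqrt 5) / 2\<close>.

  Resistances enter only through the Dirichlet principle: a resistance bound is a bound of
  squared potential differences by the energy. With it, the hitting time estimate is a maximum
  argument (\<open>le_card_mult_resistance\<close>) that needs no existence theory for the hitting time
  equations, and the independence of the starting vertex, which makes \<^const>\<open>kemeny\<close> well defined,
  follows because a harmonic function has energy zero (\<open>sum_deg_hit_const\<close>). The link between these
  linear-algebraic hitting times and the random walk on the trajectory space is the tail-sum
  formula, with survival probabilities computed as sums over finite paths
  (\<open>emeasure_random_walk_stays\<close>).
\<close>

section \<open>Survival probabilities of the walk\<close>

definition transition :: "('a \<times> 'a) set \<Rightarrow> 'a \<Rightarrow> 'a \<Rightarrow> real" where
  "transition A u v = of_bool ((u, v) \<in> A) / real (card (A `` {u}))"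

text \<open>
  One step of the walk that is killed on leaving \<open>B\<close>: the substochastic matrix obtained from the
  transition matrix by deleting all rows and columns outside \<open>B\<close>. Applied \<open>t\<close> times to the
  indicator of \<open>B\<close> it yields the probability that the walk from \<open>u\<close> spends the times
  \<open>0, ..., t\<close> in \<open>B\<close>.
\<close>

definition killed_step :: "('a \<times> 'a) set \<Rightarrow> 'a set \<Rightarrow> ('a \<Rightarrow> real) \<Rightarrow> 'a \<Rightarrow> real" where
  "killed_step A B g u = of_bool (u \<in> B) * (\<Sum>v\<in>B. transition A u v * g v)"

definition survival :: "('a \<times> 'a) set \<Rightarrow> 'a set \<Rightarrow> nat \<Rightarrow> 'a \<Rightarrow> real" where
  "survival A B t = (killed_step A B ^^ t) (\<lambda>u. of_bool (u \<in> B))"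

lemma transition_nonneg: "transition A u v \<ge> 0"
  by (simp add: transition_def)

lemma survival_0: "survival A B 0 u = of_bool (u \<in> B)"
  by (simp add: survival_def)

lemma survival_Suc: "survival A B (Suc t) = killed_step A B (survival A B t)"
  by (simp add: survival_def)

lemma survival_nonneg: "survival A B t u \<ge> 0"
  by (induction t arbitrary: u)
    (auto simp: survival_0 survival_Suc killed_step_def transition_nonneg intro!: sum_nonneg)

lemma survival_outside: "u \<notin> B \<Longrightarrow> survival A B t u = 0"
  by (cases t) (simp_all add: survival_0 survival_Suc killed_step_def)

text \<open>
  Expanding a matrix power as a sum over paths. The weight \<open>g\<close> at the endpoint is what makes the
  induction work: splitting off the last step of the path replaces \<open>g\<close> by its one-step average.
\<close>

lemma sum_paths_eq_killed_step:
  fixes g :: "'a \<Rightarrow> real"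
  assumes "finite B"
  shows "(\<Sum>x\<in>PiE {..t} (\<lambda>_. B). of_bool (x 0 = i) *
      (\<Prod>k<t. transition A (x k) (x (Suc k))) * g (x t)) =
    (killed_step A B ^^ t) (\<lambda>u. of_bool (u \<in> B) * g u) i"
proof (induction t arbitrary: g)
  case 0
  have "{..0::nat} = insert 0 {}" by auto
  then have P: "PiE {..0::nat} (\<lambda>_. B) = (\<lambda>(y, g). g(0 := y)) ` (B \<times> {\<lambda>_. undefined})"
    by (simp only: PiE_insert_eq PiE_empty_domain)
  have inj: "inj_on (\<lambda>(y, g). g(0 := y)) (B \<times> {\<lambda>_::nat. undefined})"
    using inj_combinator[of 0 "{}" "\<lambda>_. B"] by simp
  have "(\<Sum>x\<in>PiE {..0} (\<lambda>_. B). of_bool (x 0 = i) *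
      (\<Prod>k<0. transition A (x k) (x (Suc k))) * g (x 0)) = (\<Sum>v\<in>B. of_bool (v = i) * g v)"
    unfolding P sum.reindex[OF inj] sum.cartesian_product' by simp
  also have "\<dots> = (\<Sum>v\<in>B. if v = i then g v else 0)"
    by (intro sum.cong refl) simp
  also have "\<dots> = of_bool (i \<in> B) * g i"
    using assms by (simp add: sum.delta)
  finally show ?case
    by simp
next
  case (Suc t)
  have P: "PiE {..Suc t} (\<lambda>_. B) = (\<lambda>(y, g). g(Suc t := y)) ` (B \<times> PiE {..t} (\<lambda>_. B))"
    by (simp add: atMost_Suc PiE_insert_eq)
  have inj: "inj_on (\<lambda>(y, g). g(Suc t := y)) (B \<times> PiE {..t} (\<lambda>_. B))"
    using inj_combinator[of "Suc t" "{..t}" "\<lambda>_. B"] by simp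
  have "(\<Sum>x\<in>PiE {..Suc t} (\<lambda>_. B). of_bool (x 0 = i) *
      (\<Prod>k<Suc t. transition A (x k) (x (Suc k))) * g (x (Suc t))) =
    (\<Sum>v\<in>B. \<Sum>x\<in>PiE {..t} (\<lambda>_. B). of_bool (x 0 = i) *
      (\<Prod>k<t. transition A (x k) (x (Suc k))) * (transition A (x t) v * g v))"
    unfolding P sum.reindex[OF inj] sum.cartesian_product
    by (intro sum.cong refl) (auto intro!: prod.cong)
  also have "\<dots> = (\<Sum>x\<in>PiE {..t} (\<lambda>_. B). of_bool (x 0 = i) *
      (\<Prod>k<t. transition A (x k) (x (Suc k))) * (\<Sum>v\<in>B. transition A (x t) v * g v))"
    by (subst sum.swap) (simp add: sum_distrib_left)
  also have "\<dots> = (killed_step A B ^^ t) (\<lambda>u. of_bool (u \<in> B) * (\<Sum>v\<in>B. transition A u v * g v)) i"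
    by (rule Suc)
  also have "(\<lambda>u. of_bool (u \<in> B) * (\<Sum>v\<in>B. transition A u v * g v)) =
      killed_step A B (\<lambda>u. of_bool (u \<in> B) * g u)"
    by (auto simp: killed_step_def fun_eq_iff)
  finally show ?case
    by (simp add: funpow_swap1)
qed

lemma space_random_walk: "space (random_walk G i) = UNIV"
  and sets_random_walk: "sets (random_walk G i) = sets (PiM UNIV (\<lambda>_. count_space UNIV))"
  and emeasure_random_walk_UNIV: "emeasure (random_walk G i) UNIV = 1"
proof -
  interpret IT: Ionescu_Tulcea "walk_kernel G i" "\<lambda>_. count_space UNIV"
    by (rule Ionescu_Tulcea_walk_kernel)
  let ?M = "\<lambda>_::nat. count_space (UNIV :: 'a set)"
  show "space (random_walk G i) = UNIV"
    by (simp add: random_walk_def space_PiM)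
  show "sets (random_walk G i) = sets (PiM UNIV (\<lambda>_. count_space UNIV))"
    by (simp add: random_walk_def)
  have "IT.PF.emb UNIV {} {\<lambda>_. undefined} = UNIV"
    by (auto simp: prod_emb_def space_PiM)
  moreover have "emeasure IT.PF.lim (IT.PF.emb UNIV {} {\<lambda>_. undefined}) =
      emeasure (IT.CI {}) {\<lambda>_. undefined}"
    by (rule IT.lim) (auto simp: PiM_empty)
  moreover have "emeasure (IT.CI {}) (space (IT.CI {})) = 1"
    by (intro prob_space.emeasure_space_1 IT.PF.prob_space_P) auto
  ultimately show "emeasure (random_walk G i) UNIV = 1"
    by (simp add: random_walk_def IT.PF.space_P space_PiM)
qed

lemma sets_random_walk_coordinates:
  "{\<omega>. \<forall>k\<le>t. \<omega> k \<in> S k} \<in> sets (random_walk G i)"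
proof -
  have "Measurable.pred (PiM (UNIV :: nat set) (\<lambda>_. count_space UNIV)) (\<lambda>\<omega>. \<omega> k \<in> S k)" for k
    by (rule measurable_compose[where f = "\<lambda>\<omega>. \<omega> k", OF measurable_component_singleton]) auto
  then have "Measurable.pred (PiM (UNIV :: nat set) (\<lambda>_. count_space UNIV))
      (\<lambda>\<omega>. \<forall>k\<in>{..t}. \<omega> k \<in> S k)"
    by (intro pred_intros_finite) auto
  then show ?thesis
    by (simp add: sets_random_walk space_PiM Ball_def pred_def)
qed

text \<open>
  Only finitely many prefixes stay in \<open>B\<close>, and each has the product of its transition
  probabilities as its probability. Vertices of \<open>B\<close> must have a neighbour because
  \<^const>\<open>pmf_of_set\<close> is unspecified on the empty set.
\<close>

lemma emeasure_random_walk_stays: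
  assumes "finite B" and nonempty: "\<And>u. u \<in> B \<Longrightarrow> parcs G `` {u} \<noteq> {}"
    and fin: "finite (parcs G)"
  shows "emeasure (random_walk G i) {\<omega>. \<forall>k\<le>t. \<omega> k \<in> B} = ennreal (survival (parcs G) B t i)"
proof -
  let ?A = "parcs G"
  let ?pre = "\<lambda>x. {\<omega>. \<forall>k\<le>t. \<omega> k = x k}"
  have nb: "{v. (u, v) \<in> ?A} = ?A `` {u}" for u by auto
  have pmf: "pmf (pmf_of_set {v. (u, v) \<in> ?A}) v = transition ?A u v" if "u \<in> B" for u v
    unfolding nb using nonempty[OF that] fin
    by (subst pmf_of_set) (auto simp: transition_def indicator_def finite_Image)
  have meas: "?pre x \<in> sets (random_walk G i)" for x :: "nat \<Rightarrow> 'a"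
    using sets_random_walk_coordinates[of t "\<lambda>k. {x k}"] by simp
  have disj: "disjoint_family_on ?pre (PiE {..t} (\<lambda>_. B))"
    by (auto simp: disjoint_family_on_def intro!: PiE_ext)
  have "{\<omega>. \<forall>k\<le>t. \<omega> k \<in> B} = (\<Union>x\<in>PiE {..t} (\<lambda>_. B). ?pre x)"
  proof safe
    fix \<omega> :: "nat \<Rightarrow> 'a" assume "\<forall>k\<le>t. \<omega> k \<in> B"
    then show "\<omega> \<in> (\<Union>x\<in>PiE {..t} (\<lambda>_. B). ?pre x)"
      by (intro UN_I[of "restrict \<omega> {..t}"]) auto
  qed (auto simp: PiE_iff)
  then have "emeasure (random_walk G i) {\<omega>. \<forall>k\<le>t. \<omega> k \<in> B} =
      (\<Sum>x\<in>PiE {..t} (\<lambda>_. B). emeasure (random_walk G i) (?pre x))"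
    using meas disj assms(1) by (subst sum_emeasure) (auto intro!: finite_PiE)
  also have "\<dots> = (\<Sum>x\<in>PiE {..t} (\<lambda>_. B). ennreal (of_bool (x 0 = i) *
      (\<Prod>k<t. transition ?A (x k) (x (Suc k))) * 1))"
  proof (rule sum.cong)
    fix x assume x: "x \<in> PiE {..t} (\<lambda>_. B)"
    have "(\<Prod>k<t. ennreal (pmf (pmf_of_set {v. (x k, v) \<in> ?A}) (x (Suc k)))) =
        (\<Prod>k<t. ennreal (transition ?A (x k) (x (Suc k))))"
      using x by (intro prod.cong refl) (subst pmf, auto simp: PiE_iff)
    then show "emeasure (random_walk G i) (?pre x) = ennreal (of_bool (x 0 = i) *
      (\<Prod>k<t. transition ?A (x k) (x (Suc k))) * 1)"
      by (subst emeasure_random_walk_prefix)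
        (auto simp: prod_ennreal transition_nonneg indicator_def)
  qed simp
  also have "\<dots> = ennreal (survival ?A B t i)"
    by (subst sum_ennreal)
      (auto intro!: prod_nonneg simp: transition_nonneg survival_def
        sum_paths_eq_killed_step[OF assms(1), where g = "\<lambda>_. 1", simplified])
  finally show ?thesis .
qed

text \<open>
  The tail-sum formula, for each trajectory: a time \<open>t\<close> is counted as long as \<open>j\<close> has not been
  visited up to \<open>t\<close>. It also holds on trajectories that miss \<open>j\<close>, where both sides are infinite.
\<close>

lemma hitting_time_eq_suminf:
  "hitting_time j \<omega> = (\<Sum>t. indicator {\<omega>. \<forall>k\<le>t. \<omega> k \<noteq> j} \<omega>)"
proof (cases "\<exists>t. \<omega> t = j")
  case True
  define T where "T = (LEAST t. \<omega> t = j)"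
  have T: "\<omega> T = j" "\<And>t. \<omega> t = j \<Longrightarrow> T \<le> t"
    using True unfolding T_def by (auto intro: LeastI_ex Least_le)
  have "hitting_time j \<omega> = of_nat T"
    unfolding hitting_time_def using T
    by (intro antisym INF_lower INF_greatest) auto
  also have "\<dots> = (\<Sum>t<T. 1)" by simp
  also have "\<dots> = (\<Sum>t<T. indicator {\<omega>. \<forall>k\<le>t. \<omega> k \<noteq> j} \<omega>)"
  proof (intro sum.cong refl)
    fix t assume "t \<in> {..<T}"
    then have "\<forall>k\<le>t. \<omega> k \<noteq> j"
      using T(2) by (metis lessThan_iff not_le order_trans)
    then show "1 = indicator {\<omega>. \<forall>k\<le>t. \<omega> k \<noteq> j} \<omega>" by simp
  qed
  also have "\<dots> = (\<Sum>t. indicator {\<omega>. \<forall>k\<le>t. \<omega> k \<noteq> j} \<omega>)"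
    using T(1) by (intro suminf_finite[symmetric]) (auto simp: indicator_def intro!: exI[of _ T])
  finally show ?thesis .
next
  case False
  then have "hitting_time j \<omega> = top"
    by (simp add: hitting_time_def)
  moreover have "(\<Sum>t. indicator {\<omega>. \<forall>k\<le>t. \<omega> k \<noteq> j} \<omega>) = (\<Sum>t::nat. 1 :: ennreal)"
    using False by (intro suminf_cong) (auto simp: indicator_def)
  moreover have "(\<Sum>t::nat. 1 :: ennreal) = top"
    by (simp add: suminf_eq_SUP ennreal_SUP_of_nat_eq_top)
  ultimately show ?thesis by simp
qed

section \<open>Energy and resistance\<close>

text \<open>
  The Dirichlet form. Every edge contributes twice, once for each of its arcs, which accounts for
  the factors \<open>2\<close> below.
\<close>

definition energy :: "('a \<times> 'a) set \<Rightarrow> ('a \<Rightarrow> real) \<Rightarrow> real" where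
  "energy A f = (\<Sum>(u, v)\<in>A. (f u - f v)\<^sup>2)"

lemma energy_nonneg: "energy A f \<ge> 0"
  by (auto simp: energy_def intro!: sum_nonneg)

lemma energy_ge_oriented:
  assumes "finite A" "sym A" "S \<subseteq> A" "S \<inter> S\<inverse> = {}"
  shows "2 * (\<Sum>(u, v)\<in>S. (f u - f v)\<^sup>2) \<le> energy A f"
proof -
  have "finite S"
    using assms finite_subset by blast
  have "(\<Sum>(u, v)\<in>S\<inverse>. (f u - f v)\<^sup>2) = (\<Sum>(u, v)\<in>S. (f v - f u)\<^sup>2)"
    by (rule sum.reindex_bij_witness[of _ prod.swap prod.swap]) auto
  also have "\<dots> = (\<Sum>(u, v)\<in>S. (f u - f v)\<^sup>2)"
    by (simp add: power2_commute)
  finally have "2 * (\<Sum>(u, v)\<in>S. (f u - f v)\<^sup>2) = (\<Sum>(u, v)\<in>S \<union> S\<inverse>. (f u - f v)\<^sup>2)"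
    using \<open>finite S\<close> assms(4) by (simp add: sum.union_disjoint)
  also have "\<dots> \<le> energy A f"
    unfolding energy_def using assms by (intro sum_mono2) (auto dest: symD)
  finally show ?thesis .
qed

text \<open>
  Cauchy--Schwarz along a path: a path with \<open>n\<close> edges has resistance at most \<open>n\<close>. The vertices have
  to be distinct so that no edge is counted twice.
\<close>

lemma energy_ge_path:
  assumes "finite A" "sym A" and inj: "inj_on x {..n}"
    and arc: "\<And>k. k < n \<Longrightarrow> (x k, x (Suc k)) \<in> A"
  shows "2 * (f (x 0) - f (x n))\<^sup>2 \<le> real n * energy A f"
proof -
  let ?S = "(\<lambda>k. (x k, x (Suc k))) ` {..<n}"
  have inj': "inj_on (\<lambda>k. (x k, x (Suc k))) {..<n}"
    using inj by (auto simp: inj_on_def)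
  have "k = Suc l" if "x k = x (Suc l)" "k < n" "l < n" for k l
    using inj_onD[OF inj that(1)] that by auto
  then have "x k \<noteq> x (Suc l) \<or> x (Suc k) \<noteq> x l" if "k < n" "l < n" for k l
    using that by (metis n_not_Suc_n Suc_n_not_le_n le_SucI order_refl)
  then have disj: "?S \<inter> ?S\<inverse> = {}"
    by auto
  have "f (x 0) - f (x n) = (\<Sum>k<n. f (x k) - f (x (Suc k)))"
    by (rule sum_lessThan_telescope'[symmetric])
  then have "(f (x 0) - f (x n))\<^sup>2 \<le> real n * (\<Sum>k<n. (f (x k) - f (x (Suc k)))\<^sup>2)"
    using sum_squared_le_sum_of_squares[of "\<lambda>k. f (x k) - f (x (Suc k))" "{..<n}"] by (simp add: mult.commute)
  also have "(\<Sum>k<n. (f (x k) - f (x (Suc k)))\<^sup>2) = (\<Sum>(u, v)\<in>?S. (f u - f v)\<^sup>2)"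
    by (simp add: sum.reindex[OF inj'])
  finally have "2 * (f (x 0) - f (x n))\<^sup>2 \<le> real n * (2 * (\<Sum>(u, v)\<in>?S. (f u - f v)\<^sup>2))"
    by simp
  also have "\<dots> \<le> real n * energy A f"
    using assms disj by (intro mult_left_mono energy_ge_oriented) auto
  finally show ?thesis .
qed

text \<open>
  A path of length two conducts \<open>1/2\<close>, so \<open>c\<close> common neighbours give a conductance of at least
  \<open>c/2\<close> between \<open>u\<close> and \<open>v\<close>, to which an edge between \<open>u\<close> and \<open>v\<close> adds \<open>1\<close>.
\<close>

lemma energy_ge_common_neighbours:
  assumes "finite A" "sym A" "u \<noteq> v" "u \<notin> W" "v \<notin> W"
    and W: "\<And>w. w \<in> W \<Longrightarrow> (u, w) \<in> A \<and> (w, v) \<in> A"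
  shows "(real (card W) + 2 * of_bool ((u, v) \<in> A)) * (f u - f v)\<^sup>2 \<le> energy A f"
proof -
  define E where "E = (if (u, v) \<in> A then {(u, v)} else {})"
  let ?S = "(Pair u ` W \<union> (\<lambda>w. (w, v)) ` W) \<union> E"
  let ?s = "\<lambda>(u, v). (f u - f v)\<^sup>2"
  have "W \<subseteq> A `` {u}" using W by auto
  then have fin: "finite W" "finite E"
    using finite_subset[OF _ finite_Image[OF assms(1)]] by (auto simp: E_def)
  have "(f u - f v)\<^sup>2 \<le> 2 * ((f u - f w)\<^sup>2 + (f w - f v)\<^sup>2)" for w
    using sum_squares_bound[of "f u - f w" "f w - f v"] by (simp add: power2_eq_square algebra_simps)
  from this have half: "(f u - f v)\<^sup>2 / 2 \<le> (f u - f w)\<^sup>2 + (f w - f v)\<^sup>2" for w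
    by (metis mult.commute pos_divide_le_eq zero_less_numeral)
  have "sum ?s ?S = sum ?s (Pair u ` W) + sum ?s ((\<lambda>w. (w, v)) ` W) + sum ?s E"
    using fin assms(3-5) by (subst sum.union_disjoint, auto simp: E_def)+
  also have "\<dots> = (\<Sum>w\<in>W. (f u - f w)\<^sup>2 + (f w - f v)\<^sup>2) + of_bool ((u, v) \<in> A) * (f u - f v)\<^sup>2"
    by (simp add: sum.reindex inj_on_def sum.distrib E_def)
  also have "\<dots> \<ge> (\<Sum>w\<in>W. (f u - f v)\<^sup>2 / 2) + of_bool ((u, v) \<in> A) * (f u - f v)\<^sup>2"
    using half by (intro add_right_mono sum_mono) 
  finally have "2 * sum ?s ?S \<ge> (real (card W) + 2 * of_bool ((u, v) \<in> A)) * (f u - f v)\<^sup>2"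
    by (simp add: algebra_simps)
  also have "2 * sum ?s ?S \<le> energy A f"
    using assms W by (intro energy_ge_oriented) (auto simp: E_def split: if_splits)
  finally show ?thesis .
qed

locale connected_arcs =
  fixes V :: "'a set" and A :: "('a \<times> 'a) set"
  assumes finite_V: "finite V" and A_subset: "A \<subseteq> V \<times> V" and sym_A: "sym A"
    and connected: "u \<in> V \<Longrightarrow> v \<in> V \<Longrightarrow> (u, v) \<in> A\<^sup>*"
    and no_isolated: "u \<in> V \<Longrightarrow> A `` {u} \<noteq> {}"
begin

lemma finite_A: "finite A"
  using finite_subset[OF A_subset] finite_V by simp

definition deg :: "'a \<Rightarrow> real" where
  "deg u = real (card (A `` {u}))"

abbreviation avg :: "('a \<Rightarrow> real) \<Rightarrow> 'a \<Rightarrow> real" where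
  "avg f u \<equiv> \<Sum>v\<in>V. transition A u v * f v"

lemma deg_pos: "u \<in> V \<Longrightarrow> deg u > 0"
  using no_isolated[of u] finite_A by (simp add: deg_def card_gt_0_iff finite_Image)

lemma deg_nonneg: "deg u \<ge> 0"
  by (simp add: deg_def)

lemma deg_transition: "u \<in> V \<Longrightarrow> deg u * transition A u v = of_bool ((u, v) \<in> A)"
  using deg_pos[of u] by (simp add: transition_def deg_def)

lemma sum_arcs: "(\<Sum>(u, v)\<in>A. F u v) = (\<Sum>u\<in>V. \<Sum>v\<in>V. of_bool ((u, v) \<in> A) * F u v)"
  for F :: "'a \<Rightarrow> 'a \<Rightarrow> real"
proof -
  have "(\<Sum>(u, v)\<in>A. F u v) = (\<Sum>(u, v)\<in>V \<times> V. of_bool ((u, v) \<in> A) * F u v)"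
    using A_subset finite_V by (intro sum.mono_neutral_cong_left) auto
  then show ?thesis
    by (simp add: sum.cartesian_product)
qed

text \<open>
  Reversibility: \<open>deg u * transition A u v\<close> is the symmetric indicator of the arcs, so that sums
  weighted by the degrees turn into sums over arcs.
\<close>

lemma sum_deg_avg: "(\<Sum>u\<in>V. deg u * (g u * avg f u)) = (\<Sum>(u, v)\<in>A. g u * f v)"
  unfolding sum_arcs
proof (intro sum.cong refl)
  fix u assume "u \<in> V"
  have "deg u * (g u * avg f u) = (\<Sum>v\<in>V. (deg u * transition A u v) * (g u * f v))"
    by (simp add: sum_distrib_left ac_simps)
  also have "\<dots> = (\<Sum>v\<in>V. of_bool ((u, v) \<in> A) * (g u * f v))"
    using \<open>u \<in> V\<close> by (simp only: deg_transition)
  finally show "deg u * (g u * avg f u) = (\<Sum>v\<in>V. of_bool ((u, v) \<in> A) * (g u * f v))" .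
qed

lemma deg_eq_sum: "deg u = (\<Sum>v\<in>V. of_bool ((u, v) \<in> A))"
proof -
  have "A `` {u} = {v\<in>V. (u, v) \<in> A}" using A_subset by auto
  then show ?thesis
    using finite_V by (simp add: deg_def of_bool_def sum.If_cases Int_def)
qed

lemma avg_const:
  assumes u: "u \<in> V"
  shows "avg (\<lambda>_. c) u = c"
proof -
  have "deg u * avg (\<lambda>_. c) u = (\<Sum>v\<in>V. (deg u * transition A u v) * c)"
    by (simp only: sum_distrib_left mult.assoc)
  also have "\<dots> = (\<Sum>v\<in>V. of_bool ((u, v) \<in> A) * c)"
    by (simp only: deg_transition[OF u])
  also have "\<dots> = deg u * c"
    by (simp only: deg_eq_sum sum_distrib_right)
  finally show ?thesis
    using deg_pos[OF u] by simp
qed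

lemma sum_deg: "(\<Sum>u\<in>V. deg u * f u) = (\<Sum>(u, v)\<in>A. f u)"
proof -
  have "(\<Sum>u\<in>V. deg u * f u) = (\<Sum>u\<in>V. deg u * (f u * avg (\<lambda>_. 1) u))"
    by (intro sum.cong refl, subst avg_const) simp_all
  also have "\<dots> = (\<Sum>(u, v)\<in>A. f u * 1)"
    by (rule sum_deg_avg)
  finally show ?thesis by simp
qed

lemma sum_deg_eq_card: "(\<Sum>u\<in>V. deg u) = real (card A)"
  using sum_deg[of "\<lambda>_. 1"] by (simp add: split_def)

lemma sum_arcs_swap: "(\<Sum>(u, v)\<in>A. F v u) = (\<Sum>(u, v)\<in>A. F u v)"
  for F :: "'a \<Rightarrow> 'a \<Rightarrow> real"
  using sym_A by (intro sum.reindex_bij_witness[of _ prod.swap prod.swap]) (auto dest: symD)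

text \<open>
  The degrees are a stationary measure.
\<close>

lemma sum_laplacian_zero: "(\<Sum>u\<in>V. deg u * (f u - avg f u)) = 0"
proof -
  have "(\<Sum>u\<in>V. deg u * (f u - avg f u)) = (\<Sum>u\<in>V. deg u * f u) - (\<Sum>u\<in>V. deg u * (1 * avg f u))"
    by (simp add: right_diff_distrib sum_subtractf)
  also have "\<dots> = 0"
    using sum_deg[of f] sum_deg_avg[of "\<lambda>_. 1" f] sum_arcs_swap[of "\<lambda>u v. f u"] by simp
  finally show ?thesis .
qed

text \<open>
  Summation by parts (the discrete Green formula).
\<close>

lemma energy_eq: "energy A f = 2 * (\<Sum>u\<in>V. deg u * (f u * (f u - avg f u)))"
proof -
  have "energy A f = (\<Sum>(u, v)\<in>A. (f u)\<^sup>2) + (\<Sum>(u, v)\<in>A. (f v)\<^sup>2) - 2 * (\<Sum>(u, v)\<in>A. f u * f v)"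
    unfolding energy_def
    by (simp add: power2_diff split_def sum.distrib sum_subtractf sum_distrib_left ac_simps)
  also have "(\<Sum>(u, v)\<in>A. (f v)\<^sup>2) = (\<Sum>(u, v)\<in>A. (f u)\<^sup>2)"
    by (rule sum_arcs_swap)
  also have "(\<Sum>(u, v)\<in>A. (f u)\<^sup>2) = (\<Sum>u\<in>V. deg u * (f u)\<^sup>2)"
    by (rule sum_deg[symmetric])
  also have "(\<Sum>(u, v)\<in>A. f u * f v) = (\<Sum>u\<in>V. deg u * (f u * avg f u))"
    by (rule sum_deg_avg[symmetric])
  finally show ?thesis
    by (simp add: right_diff_distrib sum_subtractf power2_eq_square)
qed

text \<open>
  All effective resistances are at most \<open>\<rho>\<close>. By the Dirichlet principle the resistance between
  \<open>u\<close> and \<open>v\<close> is the largest value of \<open>(f u - f v)\<^sup>2\<close> over potentials \<open>f\<close> whose energy, counted once per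
  edge, is \<open>1\<close>.
\<close>

definition resistance_le :: "real \<Rightarrow> bool" where
  "resistance_le \<rho> \<longleftrightarrow> \<rho> \<ge> 0 \<and> (\<forall>f. \<forall>u\<in>V. \<forall>v\<in>V. 2 * (f u - f v)\<^sup>2 \<le> \<rho> * energy A f)"

section \<open>Shortest paths and the diameter\<close>

definition gdist :: "'a \<Rightarrow> 'a \<Rightarrow> nat" where
  "gdist u v = (LEAST n. (u, v) \<in> A ^^ n)"

lemma gdist_relpow:
  assumes "u \<in> V" "v \<in> V"
  shows "(u, v) \<in> A ^^ gdist u v"
proof -
  have "\<exists>n. (u, v) \<in> A ^^ n"
    using connected[OF assms] by (simp add: rtrancl_power)
  then show ?thesis
    unfolding gdist_def by (rule LeastI_ex)
qed

lemma gdist_le: "(u, v) \<in> A ^^ n \<Longrightarrow> gdist u v \<le> n"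
  unfolding gdist_def by (rule Least_le)

lemma relpow_of_path:
  assumes "\<And>k. a \<le> k \<Longrightarrow> k < a + n \<Longrightarrow> (x k, x (Suc k)) \<in> A"
  shows "(x a, x (a + n)) \<in> A ^^ n"
  using assms by (induction n) auto

text \<open>
  A shortest path visits the distances \<open>0, 1, ..., gdist u v\<close> one after the other. This makes its
  vertices distinct and places one of them in each distance layer around \<open>u\<close>.
\<close>

lemma geodesic:
  assumes "u \<in> V" "v \<in> V"
  obtains x where "x 0 = u" "x (gdist u v) = v"
    "\<And>k. k < gdist u v \<Longrightarrow> (x k, x (Suc k)) \<in> A"
    "\<And>k. k \<le> gdist u v \<Longrightarrow> x k \<in> V"
    "\<And>k. k \<le> gdist u v \<Longrightarrow> gdist u (x k) = k"
proof -
  let ?n = "gdist u v"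
  obtain x where x: "x 0 = u" "x ?n = v" "\<And>k. k < ?n \<Longrightarrow> (x k, x (Suc k)) \<in> A"
    using gdist_relpow[OF assms] by (auto simp: relpow_fun_conv)
  have V: "x k \<in> V" if "k \<le> ?n" for k
  proof (cases k)
    case (Suc l)
    then have "(x l, x k) \<in> A" using x(3)[of l] that by simp
    then show ?thesis using A_subset by auto
  qed (use x assms in auto)
  have "gdist u (x k) = k" if k: "k \<le> ?n" for k
  proof (rule antisym)
    have "(u, x k) \<in> A ^^ k"
      using relpow_of_path[of 0 k x] x k by auto
    then show "gdist u (x k) \<le> k"
      by (rule gdist_le)
    have "(x k, v) \<in> A ^^ (?n - k)"
      using relpow_of_path[of k "?n - k" x] x k by auto
    with gdist_relpow[OF assms(1) V[OF k]] have "(u, v) \<in> A ^^ (gdist u (x k) + (?n - k))"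
      by (auto simp: relpow_add)
    from gdist_le[OF this] show "k \<le> gdist u (x k)"
      using k by linarith
  qed
  with x V show ?thesis by (rule that)
qed

lemma gdist_arc: "u \<in> V \<Longrightarrow> (v, w) \<in> A \<Longrightarrow> gdist u w \<le> gdist u v + 1"
  using A_subset gdist_relpow[of u v] by (intro gdist_le) auto

lemma energy_ge_gdist:
  assumes "u \<in> V" "v \<in> V"
  shows "2 * (f u - f v)\<^sup>2 \<le> real (gdist u v) * energy A f"
proof -
  obtain x where x: "x 0 = u" "x (gdist u v) = v"
    "\<And>k. k < gdist u v \<Longrightarrow> (x k, x (Suc k)) \<in> A"
    "\<And>k. k \<le> gdist u v \<Longrightarrow> gdist u (x k) = k"
    using geodesic[OF assms] by metis
  have "inj_on x {..gdist u v}"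
    by (rule inj_on_inverseI[of _ "gdist u"]) (simp add: x)
  from energy_ge_path[OF finite_A sym_A this x(3), of f] show ?thesis
    by (simp add: x)
qed

lemma resistance_le_diameter:
  assumes "\<And>u v. u \<in> V \<Longrightarrow> v \<in> V \<Longrightarrow> gdist u v \<le> D"
  shows "resistance_le (real D)"
  unfolding resistance_le_def
proof (intro conjI allI ballI)
  fix f :: "'a \<Rightarrow> real" and u v assume "u \<in> V" "v \<in> V"
  then have "2 * (f u - f v)\<^sup>2 \<le> real (gdist u v) * energy A f"
    by (rule energy_ge_gdist)
  also have "\<dots> \<le> real D * energy A f"
    using assms[OF \<open>u \<in> V\<close> \<open>v \<in> V\<close>] by (intro mult_right_mono energy_nonneg) simp
  finally show "2 * (f u - f v)\<^sup>2 \<le> real D * energy A f" .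
qed simp

lemma ex_diameter:
  assumes "V \<noteq> {}"
  obtains a b where "a \<in> V" "b \<in> V" "\<And>u v. u \<in> V \<Longrightarrow> v \<in> V \<Longrightarrow> gdist u v \<le> gdist a b"
proof -
  define S where "S = (\<lambda>(u, v). gdist u v) ` (V \<times> V)"
  have S: "finite S" "S \<noteq> {}"
    using assms finite_V by (auto simp: S_def)
  obtain a b where "a \<in> V" "b \<in> V" "gdist a b = Max S"
    using Max_in[OF S] by (auto simp: S_def)
  moreover have "gdist u v \<le> Max S" if "u \<in> V" "v \<in> V" for u v
    using that S by (intro Max_ge) (auto simp: S_def)
  ultimately show ?thesis by (metis that)
qed

section \<open>Hitting times by the energy method\<close>

text \<open>
  The analogue for one-sided hitting times of the commute time identity, which bounds them by the
  number of arcs times the resistance. A function \<open>f\<close> with \<open>f \<le> 1 + avg f\<close> off \<open>j\<close> has energy at most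
  \<open>2 * card A * M\<close>, where \<open>M\<close> is its maximum, by summation by parts. On the other hand the drop from
  its maximum to its zero \<open>j\<close> forces the energy to be at least \<open>2 * M\<^sup>2 / \<rho>\<close>. Only an inequality
  is required of \<open>f\<close>, so the estimate applies to truncated hitting times, and thereby proves that
  the expected hitting times are finite.
\<close>

lemma le_card_mult_resistance:
  assumes \<rho>: "resistance_le \<rho>" and j: "j \<in> V"
    and nonneg: "\<And>u. u \<in> V \<Longrightarrow> f u \<ge> 0" and zero: "f j = 0"
    and sub: "\<And>u. u \<in> V \<Longrightarrow> u \<noteq> j \<Longrightarrow> f u \<le> 1 + avg f u"
    and i: "i \<in> V"
  shows "f i \<le> real (card A) * \<rho>"
proof -
  define M where "M = Max (f ` V)"
  have fin: "finite (f ` V)" using finite_V by simp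
  obtain m where m: "m \<in> V" "f m = M"
    using Max_in[OF fin] i unfolding M_def by (metis empty_iff imageE image_is_empty)
  have M: "f u \<le> M" if "u \<in> V" for u
    using that fin by (simp add: M_def)
  have "energy A f = 2 * (\<Sum>u\<in>V. deg u * (f u * (f u - avg f u)))"
    by (rule energy_eq)
  also have "\<dots> \<le> 2 * (\<Sum>u\<in>V. deg u * M)"
  proof (intro mult_left_mono sum_mono deg_nonneg)
    fix u assume u: "u \<in> V"
    have "f u * (f u - avg f u) \<le> f u * 1"
    proof (cases "u = j")
      case False
      with sub[OF u] nonneg[OF u] show ?thesis
        by (intro mult_left_mono) auto
    qed (simp add: zero)
    with M[OF u] show "f u * (f u - avg f u) \<le> M" by simp
  qed simp
  also have "\<dots> = 2 * (real (card A) * M)"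
    by (simp add: sum_deg_eq_card sum_distrib_right[symmetric])
  finally have E: "energy A f \<le> 2 * (real (card A) * M)" .
  have "2 * (f m - f j)\<^sup>2 \<le> \<rho> * energy A f"
    using \<rho> m j by (auto simp: resistance_le_def)
  also have "\<dots> \<le> \<rho> * (2 * (real (card A) * M))"
    using E \<rho> by (intro mult_left_mono) (auto simp: resistance_le_def)
  finally have "M * M \<le> (real (card A) * \<rho>) * M"
    by (simp add: m zero power2_eq_square ac_simps)
  moreover have "0 \<le> real (card A) * \<rho>"
    using \<rho> by (simp add: resistance_le_def)
  ultimately have "M \<le> real (card A) * \<rho>"
    by (metis linorder_not_le mult_le_cancel_right order.strict_trans2)
  with M[OF i] show ?thesis by simp
qed

text \<open>
  The expected hitting time of \<open>j\<close> from \<open>i\<close> as a real number, by the tail-sum formula.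
\<close>

definition hit :: "'a \<Rightarrow> 'a \<Rightarrow> real" where
  "hit j i = (\<Sum>t. survival A (V - {j}) t i)"

lemma survival_Suc_avg:
  assumes "j \<in> V"
  shows "survival A (V - {j}) (Suc t) u = of_bool (u \<in> V - {j}) * avg (survival A (V - {j}) t) u"
proof -
  have "(\<Sum>v\<in>V - {j}. transition A u v * survival A (V - {j}) t v) =
      avg (survival A (V - {j}) t) u"
    using finite_V assms by (simp add: sum.remove survival_outside)
  then show ?thesis
    by (simp add: survival_Suc killed_step_def)
qed

lemma sum_survival_le:
  assumes \<rho>: "resistance_le \<rho>" and j: "j \<in> V" and i: "i \<in> V"
  shows "(\<Sum>t<n. survival A (V - {j}) t i) \<le> real (card A) * \<rho>"
proof (rule le_card_mult_resistance[OF \<rho> j _ _ _ i])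
  let ?s = "survival A (V - {j})"
  show "0 \<le> (\<Sum>t<n. ?s t u)" for u
    by (intro sum_nonneg survival_nonneg)
  show "(\<Sum>t<n. ?s t j) = 0"
    by (simp add: survival_outside)
  fix u assume u: "u \<in> V" "u \<noteq> j"
  have "(\<Sum>t<n. ?s t u) \<le> (\<Sum>t<Suc n. ?s t u)"
    using survival_nonneg by simp
  also have "\<dots> = 1 + (\<Sum>t<n. avg (?s t) u)"
    using u by (simp add: sum.lessThan_Suc_shift survival_0 survival_Suc_avg[OF j] del: sum.lessThan_Suc)
  also have "(\<Sum>t<n. avg (?s t) u) = avg (\<lambda>v. \<Sum>t<n. ?s t v) u"
    by (subst sum.swap) (simp add: sum_distrib_left)
  finally show "(\<Sum>t<n. ?s t u) \<le> 1 + avg (\<lambda>v. \<Sum>t<n. ?s t v) u" .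
qed

lemma ex_resistance_le:
  assumes "V \<noteq> {}"
  shows "\<exists>\<rho>. resistance_le \<rho>"
  using ex_diameter[OF assms] resistance_le_diameter by metis

lemma summable_survival:
  assumes "j \<in> V" "i \<in> V"
  shows "summable (\<lambda>t. survival A (V - {j}) t i)"
proof -
  obtain \<rho> where "resistance_le \<rho>"
    using ex_resistance_le assms by auto
  then show ?thesis
    using sum_survival_le[OF _ assms] by (intro summableI_nonneg_bounded survival_nonneg) auto
qed

lemma hit_nonneg: "j \<in> V \<Longrightarrow> i \<in> V \<Longrightarrow> hit j i \<ge> 0"
  unfolding hit_def by (intro suminf_nonneg summable_survival survival_nonneg)

lemma hit_le: "resistance_le \<rho> \<Longrightarrow> j \<in> V \<Longrightarrow> i \<in> V \<Longrightarrow> hit j i \<le> real (card A) * \<rho>"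
  unfolding hit_def by (intro suminf_le_const summable_survival sum_survival_le)

lemma hit_self: "hit j j = 0"
  by (simp add: hit_def survival_outside)

lemma hit_step:
  assumes "j \<in> V" "u \<in> V" "u \<noteq> j"
  shows "hit j u = 1 + avg (hit j) u"
proof -
  let ?s = "survival A (V - {j})"
  have "hit j u = (\<Sum>t. ?s (Suc t) u) + ?s 0 u"
    unfolding hit_def using suminf_split_head[OF summable_survival[OF assms(1,2)]] by simp
  also have "\<dots> = 1 + (\<Sum>t. avg (?s t) u)"
    using assms by (simp add: survival_0 survival_Suc_avg)
  also have "(\<Sum>t. avg (?s t) u) = (\<Sum>v\<in>V. \<Sum>t. transition A u v * ?s t v)"
    using summable_survival[OF assms(1)] by (intro suminf_sum summable_mult) auto
  also have "\<dots> = avg (hit j) u"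
    unfolding hit_def using summable_survival[OF assms(1)]
    by (intro sum.cong refl suminf_mult) auto
  finally show ?thesis .
qed

text \<open>
  Off \<open>j\<close> this is the first-step equation. At \<open>j\<close> the value is forced, because the degree-weighted
  sum of a Laplacian vanishes; there it says that the mean return time to \<open>j\<close> is
  \<open>card A / deg j\<close>.
\<close>

lemma hit_laplacian:
  assumes "j \<in> V" "u \<in> V"
  shows "deg j * (hit j u - avg (hit j) u) = deg j - of_bool (u = j) * real (card A)"
proof (cases "u = j")
  case False
  then show ?thesis using hit_step[OF assms] by simp
next
  case True
  have "0 = (\<Sum>u\<in>V. deg u * (hit j u - avg (hit j) u))"
    by (rule sum_laplacian_zero[symmetric])
  also have "\<dots> = deg j * (hit j j - avg (hit j) j) + (\<Sum>u\<in>V - {j}. deg u * (hit j u - avg (hit j) u))"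
    using finite_V assms by (intro sum.remove)
  also have "(\<Sum>u\<in>V - {j}. deg u * (hit j u - avg (hit j) u)) = (\<Sum>u\<in>V - {j}. deg u)"
    using hit_step[OF assms(1)] by (intro sum.cong refl) simp
  also have "\<dots> = real (card A) - deg j"
    using sum.remove[OF finite_V assms(1), of deg] by (simp add: sum_deg_eq_card)
  finally show ?thesis
    using True by simp
qed

text \<open>
  The random target lemma. Summing the Laplacians of the \<open>hit j\<close> over \<open>j\<close> shows that the weighted
  sum is a harmonic function of the starting vertex. It therefore has energy zero, and so is
  constant on a connected graph.
\<close>

lemma sum_deg_hit_const:
  assumes "i \<in> V" "i' \<in> V"
  shows "(\<Sum>j\<in>V. deg j * hit j i) = (\<Sum>j\<in>V. deg j * hit j i')"
proof -
  define F where "F u = (\<Sum>j\<in>V. deg j * hit j u)" for u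
  have harmonic: "F u - avg F u = 0" if u: "u \<in> V" for u
  proof -
    have "avg F u = (\<Sum>j\<in>V. deg j * avg (hit j) u)"
      unfolding F_def sum_distrib_left by (subst sum.swap) (simp add: ac_simps)
    then have "F u - avg F u = (\<Sum>j\<in>V. deg j * (hit j u - avg (hit j) u))"
      by (simp add: F_def right_diff_distrib sum_subtractf)
    also have "\<dots> = (\<Sum>j\<in>V. deg j - of_bool (u = j) * real (card A))"
      using hit_laplacian u by (intro sum.cong refl)
    also have "\<dots> = (\<Sum>j\<in>V. deg j) - (\<Sum>j\<in>V. if u = j then real (card A) else 0)"
      by (subst sum_subtractf) (auto intro!: sum.cong)
    also have "\<dots> = 0"
      using finite_V u by (simp add: sum_deg_eq_card)
    finally show ?thesis .
  qed
  then have "energy A F = 0"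
    by (simp add: energy_eq)
  then have "(F i - F i')\<^sup>2 \<le> 0"
    using energy_ge_gdist[OF assms, of F] by simp
  then show ?thesis by (simp add: F_def)
qed

end

section \<open>Kemeny's constant of a connected graph\<close>

lemma connected_arcs_pair_graph:
  assumes G: "pair_graph G" and card: "card (pverts G) \<ge> 2"
    and conn: "Digraph_Component.connected (with_proj G)"
  shows "connected_arcs (pverts G) (parcs G)"
proof -
  interpret pair_graph G by fact
  have sym: "sym (parcs G)"
    using pair_sym_arcs by (simp add: symmetric_def)
  then have "symcl (parcs G) = parcs G"
    by (auto simp: symcl_def dest: symD)
  then have path: "(u, v) \<in> (parcs G)\<^sup>*" if "u \<in> pverts G" "v \<in> pverts G" for u v
    using conn that rtrancl_on_rtranclI[of u v "pverts G" "parcs G"]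
    by (simp add: connected_conv)
  show ?thesis
  proof
    show "finite (pverts G)" by (rule pair_finite_verts)
    show "parcs G \<subseteq> pverts G \<times> pverts G" using wellformed' by auto
    show "parcs G `` {u} \<noteq> {}" if u: "u \<in> pverts G" for u
    proof -
      have "\<not> pverts G \<subseteq> {u}"
        using card card_mono[of "{u}" "pverts G"] by auto
      then obtain v where "v \<in> pverts G" "v \<noteq> u" by auto
      with path[OF u this(1)] show ?thesis
        by (auto elim: converse_rtranclE)
    qed
  qed (use sym path in auto)
qed

text \<open>
  A trajectory in the product space that avoids \<open>j\<close> may leave the vertex set, but only with
  probability zero. So avoiding \<open>j\<close> is almost surely the same as staying in the finite set
  \<open>pverts G - {j}\<close>, whose survival probabilities are known.
\<close>

lemma expected_hitting_time_eq_hit: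
  assumes "connected_arcs (pverts G) (parcs G)" and j: "j \<in> pverts G" and i: "i \<in> pverts G"
  shows "expected_hitting_time G i j = ennreal (connected_arcs.hit (pverts G) (parcs G) j i)"
proof -
  let ?V = "pverts G" and ?A = "parcs G" and ?P = "random_walk G i"
  interpret connected_arcs ?V ?A by fact
  interpret prob_space ?P
    by standard (simp add: space_random_walk emeasure_random_walk_UNIV)
  have "survival ?A ?V t u = of_bool (u \<in> ?V)" for t u
  proof (induction t arbitrary: u)
    case (Suc t)
    then show ?case
      using avg_const[of u 1] by (auto simp: survival_Suc killed_step_def)
  qed (simp add: survival_0)
  then have stays: "emeasure ?P {\<omega>. \<forall>k\<le>t. \<omega> k \<in> ?V} = 1" for t
    using emeasure_random_walk_stays[OF finite_V no_isolated finite_A, of i t] i by simp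
  have in_V: "AE \<omega> in ?P. \<forall>k\<le>t. \<omega> k \<in> ?V" for t
    using stays[of t] sets_random_walk_coordinates[of t "\<lambda>_. ?V" G i]
    by (intro AE_I_eq_1) (simp_all add: space_random_walk)
  then have avoid: "emeasure ?P {\<omega>. \<forall>k\<le>t. \<omega> k \<noteq> j} = ennreal (survival ?A (?V - {j}) t i)" for t
  proof -
    have "emeasure ?P {\<omega>. \<forall>k\<le>t. \<omega> k \<noteq> j} = emeasure ?P {\<omega>. \<forall>k\<le>t. \<omega> k \<in> ?V - {j}}"
    proof (rule emeasure_eq_AE)
      show "AE \<omega> in ?P. (\<omega> \<in> {\<omega>. \<forall>k\<le>t. \<omega> k \<noteq> j}) = (\<omega> \<in> {\<omega>. \<forall>k\<le>t. \<omega> k \<in> ?V - {j}})"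
        using in_V[of t] by eventually_elim auto
    qed (use sets_random_walk_coordinates[of t "\<lambda>_. - {j}" G i]
        sets_random_walk_coordinates[of t "\<lambda>_. ?V - {j}" G i] in simp_all)
    also have "\<dots> = ennreal (survival ?A (?V - {j}) t i)"
      by (rule emeasure_random_walk_stays) (use finite_V finite_A no_isolated in auto)
    finally show ?thesis .
  qed
  have "expected_hitting_time G i j = (\<integral>\<^sup>+\<omega>. (\<Sum>t. indicator {\<omega>. \<forall>k\<le>t. \<omega> k \<noteq> j} \<omega>) \<partial>?P)"
    by (simp add: expected_hitting_time_def hitting_time_eq_suminf[abs_def])
  also have "\<dots> = (\<Sum>t. \<integral>\<^sup>+\<omega>. indicator {\<omega>. \<forall>k\<le>t. \<omega> k \<noteq> j} \<omega> \<partial>?P)"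
    using sets_random_walk_coordinates[of _ "\<lambda>_. - {j}" G i]
    by (intro nn_integral_suminf borel_measurable_indicator) simp
  also have "\<dots> = (\<Sum>t. emeasure ?P {\<omega>. \<forall>k\<le>t. \<omega> k \<noteq> j})"
    using sets_random_walk_coordinates[of _ "\<lambda>_. - {j}" G i]
    by (intro suminf_cong nn_integral_indicator) simp
  also have "\<dots> = ennreal (hit j i)"
    unfolding avoid hit_def
    by (rule suminf_ennreal2) (auto intro: survival_nonneg summable_survival j i)
  finally show ?thesis .
qed

lemma kemeny_le:
  assumes G: "connected_arcs (pverts G) (parcs G)" and ne: "pverts G \<noteq> {}"
    and \<rho>: "connected_arcs.resistance_le (pverts G) (parcs G) \<rho>"
  shows "kemeny G \<le> ennreal (real (card (parcs G)) * \<rho>)"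
proof -
  let ?V = "pverts G" and ?A = "parcs G"
  interpret connected_arcs ?V ?A by fact
  have deg: "real (out_degree (with_proj G) j) = deg j" for j
  proof -
    have "bij_betw snd (out_arcs (with_proj G) j) (?A `` {j})"
      by (auto simp: bij_betw_def inj_on_def out_arcs_def image_iff)
    then show ?thesis
      by (simp add: out_degree_def deg_def bij_betw_same_card)
  qed
  have kemeny_from: "kemeny_from G i = ennreal ((\<Sum>j\<in>?V. deg j * hit j i) / real (card ?A))"
    if i: "i \<in> ?V" for i
  proof -
    have "kemeny_from G i = (\<Sum>j\<in>?V. ennreal (deg j / real (card ?A)) * ennreal (hit j i))"
      unfolding kemeny_from_def deg using i
      by (intro sum.cong refl) (simp add: expected_hitting_time_eq_hit[OF G])
    also have "\<dots> = (\<Sum>j\<in>?V. ennreal (deg j / real (card ?A) * hit j i))"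
      using i by (intro sum.cong refl ennreal_mult[symmetric]) (auto simp: deg_nonneg hit_nonneg)
    also have "\<dots> = ennreal ((\<Sum>j\<in>?V. deg j * hit j i) / real (card ?A))"
      using i by (subst sum_ennreal) (auto simp: deg_nonneg hit_nonneg sum_divide_distrib)
    finally show ?thesis .
  qed
  obtain i where i: "i \<in> ?V" using ne by auto
  have "kemeny G = kemeny_from G i"
    unfolding kemeny_def
  proof (rule the_equality)
    show "\<forall>u\<in>?V. kemeny_from G u = kemeny_from G i"
    proof
      fix u assume u: "u \<in> ?V"
      show "kemeny_from G u = kemeny_from G i"
        unfolding kemeny_from[OF u] kemeny_from[OF i] sum_deg_hit_const[OF u i] ..
    qed
  next
    fix k assume k: "\<forall>u\<in>?V. kemeny_from G u = k"
    show "k = kemeny_from G i"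
      by (rule bspec[OF k i, symmetric])
  qed
  also have "\<dots> \<le> ennreal (real (card ?A) * \<rho>)"
    unfolding kemeny_from[OF i]
  proof (rule ennreal_leI)
    have "(\<Sum>j\<in>?V. deg j * hit j i) \<le> (\<Sum>j\<in>?V. deg j * (real (card ?A) * \<rho>))"
      using i \<rho> by (intro sum_mono mult_left_mono hit_le deg_nonneg)
    also have "\<dots> = real (card ?A) * (real (card ?A) * \<rho>)"
      by (simp add: sum_deg_eq_card sum_distrib_right[symmetric])
    finally have "(\<Sum>j\<in>?V. deg j * hit j i) / real (card ?A) \<le>
        real (card ?A) * (real (card ?A) * \<rho>) / real (card ?A)"
      by (rule divide_right_mono) simp
    then show "(\<Sum>j\<in>?V. deg j * hit j i) / real (card ?A) \<le> real (card ?A) * \<rho>"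
      by (cases "card ?A = 0") simp_all
  qed
  finally show ?thesis .
qed

section \<open>Resistances in the complement\<close>

lemma card_near_le: "card {k::nat. a \<le> k + 1 \<and> k \<le> a + 1} \<le> 3"
proof -
  have "{k. a \<le> k + 1 \<and> k \<le> a + 1} \<subseteq> {a - 1..a + 1}" by auto
  from card_mono[OF _ this] show ?thesis by simp
qed

text \<open>
  Vertices whose distances from \<open>a\<close> differ by at least two are adjacent in the complement. A
  shortest path from \<open>a\<close> to \<open>b\<close> has a vertex in each of its \<open>gdist a b + 1\<close> distance layers, and all
  of these that are not within one layer of \<open>u\<close> or \<open>v\<close> are common neighbours of \<open>u\<close> and \<open>v\<close>. If
  \<open>u\<close> and \<open>v\<close> are adjacent in the complement, at most six layers are excluded, and the edge makes
  up for two of them. Otherwise \<open>u\<close> and \<open>v\<close> lie in the same or in consecutive layers, and at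
  most four are excluded. Either way the conductance is at least \<open>(gdist a b - 3) / 2\<close>.
\<close>

lemma (in connected_arcs) energy_complement_ge:
  assumes a: "a \<in> V" and b: "b \<in> V" and u: "u \<in> V" and v: "v \<in> V"
  defines "A' \<equiv> {(u, v). u \<in> V \<and> v \<in> V \<and> u \<noteq> v \<and> (u, v) \<notin> A}"
  shows "(real (gdist a b) - 3) * (f u - f v)\<^sup>2 \<le> energy A' f"
proof (cases "u = v")
  case True
  then show ?thesis by (simp add: energy_nonneg)
next
  case False
  define D where "D = gdist a b"
  define l where "l = gdist a"
  have adj: "l w \<le> l z + 1 \<and> l z \<le> l w + 1" if "(w, z) \<in> A" for w z
    using that gdist_arc[OF a] sym_A by (auto simp: l_def dest: symD)
  obtain x where x: "\<And>k. k \<le> D \<Longrightarrow> x k \<in> V" "\<And>k. k \<le> D \<Longrightarrow> l (x k) = k"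
    using geodesic[OF a b] unfolding D_def l_def by metis
  \<comment> \<open>the layers in which a neighbour of \<open>w\<close>, or \<open>w\<close> itself, can lie\<close>
  define near where "near w = {k. l w \<le> k + 1 \<and> k \<le> l w + 1}" for w
  define K where "K = {..D} - (near u \<union> near v)"
  have fin_near: "finite (near w)" for w
    by (rule finite_subset[of _ "{..l w + 1}"]) (auto simp: near_def)
  have far: "(w, x k) \<in> A' \<and> (x k, w) \<in> A' \<and> x k \<noteq> w" if "w \<in> V" "k \<le> D" "k \<notin> near w" for w k
  proof -
    have "x k \<noteq> w" "(w, x k) \<notin> A" "(x k, w) \<notin> A"
      using that(3) x(2)[OF that(2)] adj[of w "x k"] adj[of "x k" w] by (auto simp: near_def)
    then show ?thesis
      using that(1) x(1)[OF that(2)] by (auto simp: A'_def)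
  qed
  have inj: "inj_on x K"
    by (rule inj_on_inverseI[of _ l]) (auto simp: K_def x)
  have card_K: "D + 1 \<le> card K + card (near u \<union> near v)"
    using diff_card_le_card_Diff[of "near u \<union> near v" "{..D}"] fin_near by (simp add: K_def)
  have ineq: "real D - 3 \<le> real (card (x ` K)) + 2 * of_bool ((u, v) \<in> A')"
  proof (cases "(u, v) \<in> A'")
    case True
    have "card (near u \<union> near v) \<le> 6"
      using card_Un_le[of "near u" "near v"] card_near_le[of "l u"] card_near_le[of "l v"]
      unfolding near_def by linarith
    with card_K True show ?thesis by (simp add: card_image[OF inj])
  next
    case False
    then have "(u, v) \<in> A"
      using u v \<open>u \<noteq> v\<close> by (simp add: A'_def)
    then have "near u \<union> near v \<subseteq> {min (l u) (l v) - 1..min (l u) (l v) + 2}"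
      using adj by (fastforce simp: near_def)
    from card_mono[OF _ this] have "card (near u \<union> near v) \<le> 4"
      by simp
    with card_K False show ?thesis by (simp add: card_image[OF inj])
  qed
  have "(real D - 3) * (f u - f v)\<^sup>2 \<le>
      (real (card (x ` K)) + 2 * of_bool ((u, v) \<in> A')) * (f u - f v)\<^sup>2"
    by (rule mult_right_mono[OF ineq]) simp
  also have "\<dots> \<le> energy A' f"
  proof (rule energy_ge_common_neighbours)
    show "finite A'"
      by (rule finite_subset[of _ "V \<times> V"]) (auto simp: A'_def finite_V)
    show "sym A'"
      using sym_A by (auto simp: A'_def sym_def)
    show "(u, w) \<in> A' \<and> (w, v) \<in> A'" if "w \<in> x ` K" for w
      using that far u v by (auto simp: K_def)
    show "u \<notin> x ` K" "v \<notin> x ` K"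
      using far u v by (auto simp: K_def)
  qed fact
  finally show ?thesis by (simp add: D_def)
qed

text \<open>
  If the diameter \<open>D\<close> of \<open>A\<close> is at least \<open>4\<close>, then \<open>D\<close> and \<open>2 / (D - 3)\<close> bound the resistances
  of \<open>A\<close> and of its complement, and \<open>2 * D / (D - 3) \<le> 8\<close>. The bound \<open>9\<close> is the one that
  remains when both diameters are at most \<open>3\<close>.
\<close>

lemma diameter_le_3_or_resistance_product_le:
  assumes "connected_arcs V A" "V \<noteq> {}"
  defines "A' \<equiv> {(u, v). u \<in> V \<and> v \<in> V \<and> u \<noteq> v \<and> (u, v) \<notin> A}"
  assumes co: "connected_arcs V A'"
  shows "(\<forall>u\<in>V. \<forall>v\<in>V. connected_arcs.gdist A u v \<le> 3) \<or>
    (\<exists>\<rho> \<rho>'. connected_arcs.resistance_le V A \<rho> \<and> connected_arcs.resistance_le V A' \<rho>' \<and> \<rho> * \<rho>' \<le> 9)"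
proof -
  interpret G: connected_arcs V A by fact
  interpret co: connected_arcs V A' by fact
  obtain a b where ab: "a \<in> V" "b \<in> V" "\<And>u v. u \<in> V \<Longrightarrow> v \<in> V \<Longrightarrow> G.gdist u v \<le> G.gdist a b"
    using G.ex_diameter[OF assms(2)] by metis
  show ?thesis
  proof (cases "G.gdist a b \<le> 3")
    case True
    then show ?thesis using ab(3) order_trans by blast
  next
    case False
    define D where "D = real (G.gdist a b)"
    have D: "D \<ge> 4" using False by (simp add: D_def)
    have "co.resistance_le (2 / (D - 3))"
      unfolding co.resistance_le_def
    proof (intro conjI allI ballI)
      fix f :: "'a \<Rightarrow> real" and u v assume "u \<in> V" "v \<in> V"
      then have "(D - 3) * (f u - f v)\<^sup>2 \<le> energy A' f"
        unfolding D_def A'_def using ab by (intro G.energy_complement_ge)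
      then show "2 * (f u - f v)\<^sup>2 \<le> 2 / (D - 3) * energy A' f"
        using D by (simp add: field_simps)
    qed (use D in simp)
    moreover have "G.resistance_le D"
      unfolding D_def using ab(3) by (rule G.resistance_le_diameter)
    moreover have "D * (2 / (D - 3)) \<le> 9"
      using D by (simp add: field_simps)
    ultimately show ?thesis by blast
  qed
qed

section \<open>The product of the two constants\<close>

lemma card_mult_le_square:
  fixes V :: "'a set"
  assumes "finite V" "A \<subseteq> V \<times> V" "B \<subseteq> V \<times> V" "A \<inter> B = {}"
  shows "4 * (real (card A) * real (card B)) \<le> real (card V) ^ 4"
proof -
  have fin: "finite A" "finite B"
    using assms finite_subset[of _ "V \<times> V"] by auto
  have "card A + card B = card (A \<union> B)"
    using fin assms by (simp add: card_Un_disjoint)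
  also have "\<dots> \<le> card (V \<times> V)"
    using assms by (intro card_mono) auto
  finally have "real (card A + card B) \<le> real (card V) ^ 2"
    by (simp add: card_cartesian_product power2_eq_square flip: of_nat_mult)
  then have le: "real (card A) + real (card B) \<le> real (card V) ^ 2"
    by simp
  have "4 * (real (card A) * real (card B)) \<le> (real (card A) + real (card B))\<^sup>2"
    using zero_le_power2[of "real (card A) - real (card B)"]
    by (simp add: power2_eq_square algebra_simps)
  also have "\<dots> \<le> (real (card V) ^ 2)\<^sup>2"
    by (rule power_mono[OF le]) simp
  finally show ?thesis by simp
qed

lemma parcs_graph_complement:
  "parcs (graph_complement G) = {(u, v). u \<in> pverts G \<and> v \<in> pverts G \<and> u \<noteq> v \<and> (u, v) \<notin> parcs G}"
  and pverts_graph_complement: "pverts (graph_complement G) = pverts G"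
  by (simp_all add: graph_complement_def)

lemma kemeny_product_le:
  assumes G: "pair_graph G" "card (pverts G) \<ge> 2"
    "Digraph_Component.connected (with_proj G)"
    "Digraph_Component.connected (with_proj (graph_complement G))"
  shows "kemeny G * kemeny (graph_complement G)
    \<le> ennreal (9 / 4 * real (card (pverts G)) ^ 4)"
proof -
  let ?V = "pverts G" and ?A = "parcs G" and ?H = "graph_complement G"
  let ?B = "parcs ?H"
  have conn: "connected_arcs ?V ?A"
    using G by (intro connected_arcs_pair_graph)
  have conn': "connected_arcs ?V ?B"
    using connected_arcs_pair_graph[of ?H] pair_graph_graph_complement[OF G(1)] G
    by (simp add: pverts_graph_complement)
  interpret G: connected_arcs ?V ?A by fact
  interpret H: connected_arcs ?V ?B by fact
  have ne: "?V \<noteq> {}" using G(2) by auto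
  have loopfree: "(u, u) \<notin> ?A" for u
    using pair_loopfree_digraph.pair_no_loops[of G "(u, u)"] G(1)
    by (auto simp: pair_graph_def pair_digraph_def)
  have B: "?B = {(u, v). u \<in> ?V \<and> v \<in> ?V \<and> u \<noteq> v \<and> (u, v) \<notin> ?A}"
    by (rule parcs_graph_complement)
  have A: "?A = {(u, v). u \<in> ?V \<and> v \<in> ?V \<and> u \<noteq> v \<and> (u, v) \<notin> ?B}"
    unfolding B using loopfree G.A_subset by auto
  have disj: "?A \<inter> ?B = {}"
    unfolding B by auto
  have "\<exists>\<rho> \<rho>'. G.resistance_le \<rho> \<and> H.resistance_le \<rho>' \<and> \<rho> * \<rho>' \<le> 9"
  proof -
    \<comment> \<open>The dichotomy is used for both graphs, the complement of the complement being \<open>G\<close>.\<close>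
    consider "\<exists>\<rho> \<rho>'. G.resistance_le \<rho> \<and> H.resistance_le \<rho>' \<and> \<rho> * \<rho>' \<le> 9"
      | "\<exists>\<rho>' \<rho>. H.resistance_le \<rho>' \<and> G.resistance_le \<rho> \<and> \<rho>' * \<rho> \<le> 9"
      | "\<And>u v. u \<in> ?V \<Longrightarrow> v \<in> ?V \<Longrightarrow> G.gdist u v \<le> 3" "\<And>u v. u \<in> ?V \<Longrightarrow> v \<in> ?V \<Longrightarrow> H.gdist u v \<le> 3"
      using diameter_le_3_or_resistance_product_le[OF conn ne] diameter_le_3_or_resistance_product_le[OF conn' ne] conn conn'
      unfolding A[symmetric] B[symmetric] by blast
    then show ?thesis
    proof cases
      case 3
      then have "G.resistance_le 3" "H.resistance_le 3"
        using G.resistance_le_diameter[of 3] H.resistance_le_diameter[of 3] by auto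
      then show ?thesis by (intro exI[of _ 3]) simp
    next
      case 2
      then obtain \<rho>' \<rho> where "H.resistance_le \<rho>'" "G.resistance_le \<rho>" "\<rho>' * \<rho> \<le> 9"
        by blast
      then show ?thesis
        by (intro exI[of _ \<rho>] exI[of _ \<rho>']) (simp add: mult.commute)
    qed auto
  qed
  then obtain \<rho> \<rho>' where \<rho>: "G.resistance_le \<rho>" "H.resistance_le \<rho>'" "\<rho> * \<rho>' \<le> 9"
    by blast
  then have nonneg: "\<rho> \<ge> 0" "\<rho>' \<ge> 0"
    by (auto simp: G.resistance_le_def H.resistance_le_def)
  have "kemeny G * kemeny ?H \<le> ennreal (real (card ?A) * \<rho>) * ennreal (real (card ?B) * \<rho>')"
    using kemeny_le[OF conn ne \<rho>(1)] kemeny_le[of ?H \<rho>'] conn' ne \<rho>(2)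
    by (intro mult_mono) (simp_all add: pverts_graph_complement)
  also have "\<dots> = ennreal ((real (card ?A) * real (card ?B)) * (\<rho> * \<rho>'))"
    using nonneg by (simp add: ennreal_mult[symmetric] ac_simps)
  also have "\<dots> \<le> ennreal (9 / 4 * real (card ?V) ^ 4)"
  proof (rule ennreal_leI)
    have "(real (card ?A) * real (card ?B)) * (\<rho> * \<rho>') \<le> (real (card ?V) ^ 4 / 4) * 9"
      using card_mult_le_square[OF G.finite_V G.A_subset H.A_subset disj] \<rho>(3) nonneg
      by (intro mult_mono) auto
    then show "(real (card ?A) * real (card ?B)) * (\<rho> * \<rho>') \<le> 9 / 4 * real (card ?V) ^ 4"
      by simp
  qed
  finally show ?thesis .
qed

lemma kemeny_product_le_golden_ratio:
  assumes "pair_graph G" "card (pverts G) \<ge> 2"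
    "Digraph_Component.connected (with_proj G)"
    "Digraph_Component.connected (with_proj (graph_complement G))"
  shows "kemeny G * kemeny (graph_complement G)
    \<le> ennreal ((3 + sqrt 5) / 2 * real (card (pverts G)) ^ 4)"
proof -
  have "3 / 2 \<le> sqrt 5"
    by (rule real_le_rsqrt) (simp add: power2_eq_square)
  then have "9 / 4 * real (card (pverts G)) ^ 4 \<le> (3 + sqrt 5) / 2 * real (card (pverts G)) ^ 4"
    by (intro mult_right_mono) auto
  then show ?thesis
    by (rule order_trans[OF kemeny_product_le[OF assms] ennreal_leI])
qed

theorem theorem5p7:
  shows "(\<forall>G :: 'a pair_pre_digraph.
            pair_graph G \<and> card (pverts G) \<ge> 2 \<and>
            Digraph_Component.connected (with_proj G) \<and>
            Digraph_Component.connected (with_proj (graph_complement G)) \<longrightarrow>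
            kemeny G * kemeny (graph_complement G)
              \<le> ennreal ((3 + sqrt 5) / 2 * real (card (pverts G)) ^ 4)) \<and>
         (\<exists>C :: real. \<forall>G :: nat pair_pre_digraph.
            pair_graph G \<and> card (pverts G) \<ge> 2 \<and>
            Digraph_Component.connected (with_proj G) \<and>
            Digraph_Component.connected (with_proj (graph_complement G)) \<longrightarrow>
            kemeny G * kemeny (graph_complement G)
              \<le> ennreal (C * real (card (pverts G)) ^ 4))"
proof (intro conjI allI impI)
  fix G :: "'a pair_pre_digraph"
  assume "pair_graph G \<and> card (pverts G) \<ge> 2 \<and>
    Digraph_Component.connected (with_proj G) \<and>
    Digraph_Component.connected (with_proj (graph_complement G))"
  then show "kemeny G * kemeny (graph_complement G)
      \<le> ennreal ((3 + sqrt 5) / 2 * real (card (pverts G)) ^ 4)"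
    by (intro kemeny_product_le_golden_ratio) auto
next
  show "\<exists>C :: real. \<forall>G :: nat pair_pre_digraph.
            pair_graph G \<and> card (pverts G) \<ge> 2 \<and>
            Digraph_Component.connected (with_proj G) \<and>
            Digraph_Component.connected (with_proj (graph_complement G)) \<longrightarrow>
            kemeny G * kemeny (graph_complement G)
              \<le> ennreal (C * real (card (pverts G)) ^ 4)"
    by (intro exI[of _ "(3 + sqrt 5) / 2"] allI impI kemeny_product_le_golden_ratio) auto
qed

end
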